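(* For every $f\in C([0,1])$, the random variables $\varphi_n(f)=\sum_{k=1}^n f\left(\frac kn\right)\frac{\varepsilon_k}{\sqrt n}$ converge in distribution, as $n\to\infty$, to the normal distribution $N(0,\|f\|^2)$, where $\|f\|^2=\int_0^1 f^2(s)\,ds$.
   Context: $(\varepsilon_k)_{k\ge1}$ are independent random variables with $P(\varepsilon_k=1)=P(\varepsilon_k=-1)=\frac12$. $N(0,0)$ denotes the unit mass at $0$. *)

theory Defs
  imports "HOL-Probability.Probability"
begin

text \<open>
  The normal distribution, parametrised by mean and variance; for variance \<open>0\<close> it is the
  unit mass at the mean. The library's \<^const>\<open>normal_density\<close> takes the standard deviation instead
  and is identically \<open>0\<close> for standard deviation \<open>0\<close>.
\<close>

definition normal_dist :: "real \<Rightarrow> real \<Rightarrow> real measure" where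
  "normal_dist m v =
     (if v = 0 then return borel m else density lborel (normal_density m (sqrt v)))"

lemma real_distribution_normal_dist:
  assumes "v \<ge> 0"
  shows "real_distribution (normal_dist m v)"
proof (cases "v = 0")
  case True
  then show ?thesis
    by (simp add: normal_dist_def real_distribution_def real_distribution_axioms_def prob_space_return)
next
  case False
  with assms show ?thesis
    by (simp add: normal_dist_def real_distribution_def real_distribution_axioms_def
        prob_space_normal_density)
qed

definition phi :: "(nat \<Rightarrow> 'a \<Rightarrow> real) \<Rightarrow> nat \<Rightarrow> (real \<Rightarrow> real) \<Rightarrow> 'a \<Rightarrow> real" where
  "phi \<epsilon> n f \<omega> = (\<Sum>k=1..n. f (real k / real n) * (\<epsilon> k \<omega> / sqrt (real n)))"

end

theory Submission
  imports Defs
begin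

text \<open>By Levy's continuity theorem it suffices that characteristic functions converge
  pointwise. Independence makes that of \<open>phi \<epsilon> n f\<close> a product, and a symmetric
  sign scaled by \<open>c\<close> contributes \<open>cos (t * c)\<close>
  (\<open>char_distr_scaled_sign\<close>). Since \<open>cos x\<close> and
  \<open>exp (- (x\<^sup>2 / 2))\<close> differ by O(x^4) (\<open>cos_minus_exp_bound\<close>) and f
  is bounded, replacing all n cosines by exponentials costs only O(1/n). The product of the
  exponentials is the exponential of -t^2/2 times a Riemann sum of f^2, which tends to the integral
  (\<open>riemann_sum_tendsto\<close>). The limit is the characteristic function given by
  \<open>char_normal_dist\<close>, degenerate case included.\<close>

text \<open>Both functions equal 1 - x^2/2 up to a multiple of x^4: the error is at most x^4/24 in
  absolute value for the cosine, and lies between 0 and x^4/8 for the exponential. No smallness of x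
  is required.\<close>

lemma cos_minus_exp_bound: "\<bar>cos x - exp (- (x\<^sup>2 / 2))\<bar> \<le> x ^ 4" for x :: real
proof -
  define y where "y = x\<^sup>2 / 2"
  have y0: "y \<ge> 0" by (simp add: y_def)
  have y2: "y\<^sup>2 = x ^ 4 / 4" by (simp add: y_def power_divide)
  obtain t where t: "cos x = (\<Sum>m<4. cos_coeff m * x ^ m) + cos (t + 1/2 * real 4 * pi) / fact 4 * x ^ 4"
    using Maclaurin_cos_expansion[of x 4] by auto
  \<comment> \<open>The phase shift in the order-4 Lagrange remainder is a full period.\<close>
  have "cos (t + 1/2 * real 4 * pi) = cos t" by simp
  then have "cos x - (1 - y) = cos t * (x ^ 4 / 24)"
    using t by (simp add: cos_coeff_def lessThan_nat_numeral lessThan_Suc y_def fact_numeral)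
  then have "\<bar>cos x - (1 - y)\<bar> = \<bar>cos t\<bar> * (x ^ 4 / 24)"
    by (simp only: abs_mult) simp
  also have "\<dots> \<le> 1 * (x ^ 4 / 24)"
    by (intro mult_right_mono) auto
  finally have 1: "\<bar>cos x - (1 - y)\<bar> \<le> x ^ 4 / 24" by simp
  have 2: "1 - y \<le> exp (- y)" using exp_ge_add_one_self[of "- y"] by simp
  have pos: "0 < 1 + y + y\<^sup>2 / 2" using y0 by (simp add: add_pos_nonneg)
  have "exp (- y) = 1 / exp y" by (simp add: exp_minus inverse_eq_divide)
  also have "\<dots> \<le> 1 / (1 + y + y\<^sup>2 / 2)"
    using exp_lower_Taylor_quadratic[OF y0] pos by (intro divide_left_mono) auto
  also have "\<dots> \<le> 1 - y + y\<^sup>2 / 2"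
  proof -
    \<comment> \<open>This product is (1 + y^2/2)^2 - y^2, hence at least 1, so the first factor
      dominates the reciprocal of the second.\<close>
    have "(1 - y + y\<^sup>2 / 2) * (1 + y + y\<^sup>2 / 2) = 1 + (y\<^sup>2 / 2)\<^sup>2"
      by (simp add: power2_eq_square algebra_simps)
    then show ?thesis using pos by (simp add: pos_divide_le_eq)
  qed
  finally have 3: "exp (- y) \<le> 1 - y + x ^ 4 / 8" by (simp add: y2)
  have "x ^ 4 \<ge> 0" by (rule zero_le_even_power) simp
  with 1 2 3 show ?thesis unfolding y_def by linarith
qed

text \<open>On each cell of length 1/n, uniform continuity keeps g within e of its value at the
  right endpoint. The increments of an antiderivative G over the cells telescope to the integral, so
  the n cell errors of at most e/n add up to at most e.\<close>

lemma riemann_sum_tendsto: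
  fixes g :: "real \<Rightarrow> real"
  assumes cont: "continuous_on {0..1} g"
  shows "(\<lambda>n. \<Sum>k=1..n. g (real k / real n) / real n) \<longlonglongrightarrow> integral {0..1} g"
proof (rule LIMSEQ_I)
  fix r :: real assume "0 < r"
  \<comment> \<open>The cell estimates are non-strict, so e must lie strictly below r.\<close>
  define e where "e = r / 2"
  have e: "0 < e" "e < r" using \<open>0 < r\<close> by (auto simp: e_def)
  obtain G where G: "\<And>u v. u \<in> {0..1} \<Longrightarrow> v \<in> {0..1} \<Longrightarrow> u \<le> v \<Longrightarrow> (g has_integral (G v - G u)) {u..v}"
    using antiderivative_integral_continuous[OF cont] by metis
  have int: "integral {0..1} g = G 1 - G 0"
    using G[of 0 1] by (simp add: integral_unique)
  have "uniformly_continuous_on {0..1} g"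
    by (rule compact_uniformly_continuous[OF cont]) simp
  then obtain d where d: "d > 0"
    "\<And>x x'. x \<in> {0..1} \<Longrightarrow> x' \<in> {0..1} \<Longrightarrow> dist x' x < d \<Longrightarrow> dist (g x') (g x) < e"
    using e(1) unfolding uniformly_continuous_on_def by metis
  obtain N :: nat where N: "1 / d < real N" using reals_Archimedean2 by blast
  show "\<exists>no. \<forall>n\<ge>no. norm ((\<Sum>k=1..n. g (real k / real n) / real n) - integral {0..1} g) < r"
  proof (intro exI[of _ N] allI impI)
    fix n assume "N \<le> n"
    with N have nd: "1 / d < real n" by linarith
    have n: "0 < n" using less_trans[OF divide_pos_pos[OF zero_less_one d(1)] nd] by simp
    have nd': "1 / real n < d" using nd d(1) n by (simp add: field_simps)
    have piece: "\<bar>(G (real k / real n) - G (real (k - 1) / real n)) - g (real k / real n) / real n\<bar> \<le> e / real n"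
      if k: "k \<in> {1..n}" for k
    proof -
      let ?u = "real (k - 1) / real n" and ?v = "real k / real n"
      have uv: "?u \<in> {0..1}" "?v \<in> {0..1}" "?u \<le> ?v" "?v - ?u = 1 / real n"
        using k n by (auto simp: field_simps of_nat_diff)
      have "((\<lambda>x. g x - g ?v) has_integral (G ?v - G ?u) - (?v - ?u) *\<^sub>R g ?v) {?u..?v}"
        by (intro has_integral_diff G uv)
          (use has_integral_const_real[of "g ?v" ?u ?v] uv(3) in \<open>simp add: measure_lborel_Icc\<close>)
      then have "norm ((G ?v - G ?u) - (?v - ?u) *\<^sub>R g ?v) \<le> e * measure lborel {?u..?v}"
      proof (rule has_integral_bound_real[rotated 2, where S="{}"])
        fix x assume "x \<in> {?u..?v} - {}"
        then have x: "?u \<le> x" "x \<le> ?v" by auto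
        then have "x \<in> {0..1}"
          using uv(1,2) unfolding atLeastAtMost_iff by linarith
        moreover have "dist x ?v < d"
          using x uv(4) nd' unfolding dist_real_def by linarith
        ultimately show "norm (g x - g ?v) \<le> e"
          using d(2)[of ?v x] uv(2) by (simp add: dist_real_def)
      qed (use e in auto)
      then show ?thesis using uv(3,4) by (simp add: measure_lborel_Icc)
    qed
    \<comment> \<open>The upper limit m varies while the mesh 1/n stays fixed, so that induction
      applies.\<close>
    have "(\<Sum>k=1..m. G (real k / real n) - G (real (k - 1) / real n)) = G (real m / real n) - G 0" for m
      by (induction m) auto
    from this[of n] have tele: "G 1 - G 0 = (\<Sum>k=1..n. G (real k / real n) - G (real (k - 1) / real n))"
      using n by simp
    have "\<bar>(G 1 - G 0) - (\<Sum>k=1..n. g (real k / real n) / real n)\<bar>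
       = \<bar>\<Sum>k=1..n. (G (real k / real n) - G (real (k - 1) / real n)) - g (real k / real n) / real n\<bar>"
      by (simp only: tele sum_subtractf)
    also have "\<dots> \<le> (\<Sum>k=1..n. e / real n)"
      by (rule order_trans[OF sum_abs sum_mono]) (rule piece)
    also have "\<dots> = e" using n by simp
    finally show "norm ((\<Sum>k=1..n. g (real k / real n) / real n) - integral {0..1} g) < r"
      using e(2) by (simp add: int abs_minus_commute)
  qed
qed

text \<open>The unit mass at 0 gives the constant 1, matching the formula at v = 0. Otherwise
  rescaling by the standard deviation reduces to the standard normal law, evaluated at
  \<open>t * s\<close>.\<close>

lemma char_normal_dist:
  assumes "v \<ge> 0"
  shows "char (normal_dist 0 v) t = exp (- (t\<^sup>2 * v / 2))"
proof (cases "v = 0")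
  case True
  then show ?thesis by (simp add: normal_dist_def char_def integral_return)
next
  case False
  define s where "s = sqrt v"
  have s: "s > 0" "s\<^sup>2 = v" using assms False by (auto simp: s_def)
  have "char (normal_dist 0 v) t = (CLINT x|lborel. normal_density 0 s x *\<^sub>R iexp (t * x))"
    using False by (simp add: normal_dist_def char_def s_def integral_density)
  also have "\<dots> = s *\<^sub>R (CLINT x|lborel. normal_density 0 s (0 + s * x) *\<^sub>R iexp (t * (0 + s * x)))"
    using lborel_integral_real_affine[of s "\<lambda>x. normal_density 0 s x *\<^sub>R iexp (t * x)" 0] s(1)
    by simp
  also have "\<dots> = (CLINT x|lborel. s *\<^sub>R (normal_density 0 s (0 + s * x) *\<^sub>R iexp (t * (0 + s * x))))"
    by (rule integral_scaleR_right[symmetric]) 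
  also have "\<dots> = (CLINT x|lborel. std_normal_density x *\<^sub>R iexp ((t * s) * x))"
    using s(1) by (intro Bochner_Integration.integral_cong refl)
      (simp add: normal_density_def real_sqrt_mult power_mult_distrib mult_ac)
  also have "\<dots> = char std_normal_distribution (t * s)"
    by (simp add: char_def integral_density)
  also have "\<dots> = exp (- (t\<^sup>2 * v / 2))"
    by (simp add: char_std_normal_distribution power_mult_distrib s(2))
  finally show ?thesis .
qed

text \<open>The two events have total probability 1, so values of X other than 1 and -1 occur only
  on a null set; the expectation is then the mean of \<open>iexp (t * c)\<close> and its
  conjugate.\<close>

lemma (in prob_space) char_distr_scaled_sign:
  fixes X :: "'a \<Rightarrow> real"
  assumes [measurable]: "random_variable borel X"
    and p: "prob {\<omega> \<in> space M. X \<omega> = 1} = 1 / 2"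
    and m: "prob {\<omega> \<in> space M. X \<omega> = -1} = 1 / 2"
  shows "char (distr M borel (\<lambda>\<omega>. c * X \<omega>)) t = cos (t * c)"
proof -
  let ?A = "{\<omega> \<in> space M. X \<omega> = 1}" and ?B = "{\<omega> \<in> space M. X \<omega> = -1}"
  have "prob (?A \<union> ?B) = prob ?A + prob ?B"
    by (rule finite_measure_Union) auto
  then have "prob (?A \<union> ?B) = 1" using p m by simp
  then have "AE \<omega> in M. \<omega> \<in> ?A \<union> ?B"
    using prob_eq_1[of "?A \<union> ?B"] by simp
  then have "char (distr M borel (\<lambda>\<omega>. c * X \<omega>)) t
      = (CLINT \<omega>|M. indicat_real ?A \<omega> *\<^sub>R iexp (t * c) + indicat_real ?B \<omega> *\<^sub>R iexp (- (t * c)))"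
    by (simp add: char_def integral_distr, intro integral_cong_AE) auto
  also have "\<dots> = prob ?A *\<^sub>R iexp (t * c) + prob ?B *\<^sub>R iexp (- (t * c))"
    by (intro has_bochner_integral_integral_eq has_bochner_integral_add
        has_bochner_integral_scaleR_left has_bochner_integral_real_indicator)
      (auto simp: emeasure_eq_measure)
  also have "\<dots> = cos (t * c)"
    by (simp add: p m cos_exp_eq cos_of_real[symmetric] scaleR_conv_of_real field_simps)
  finally show ?thesis .
qed

text \<open>Both products run over factors in the unit disc, so their distance is at most the sum of the
  distances \<open>\<bar>cos x\<^sub>k - exp (- x\<^sub>k\<^sup>2 / 2)\<bar>\<close> with \<open>x\<^sub>k = t f(k/n) / sqrt n\<close>; each is \<open>O(n\<^sup>-\<^sup>2)\<close>.\<close>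

lemma prod_cos_tendsto:
  fixes f :: "real \<Rightarrow> real"
  assumes cont: "continuous_on {0..1} f"
  shows "(\<lambda>n. \<Prod>k=1..n. cos (t * (f (real k / real n) / sqrt (real n))))
    \<longlonglongrightarrow> exp (- (t\<^sup>2 * integral {0..1} (\<lambda>s. (f s)\<^sup>2) / 2))"
proof -
  define x where "x n k = t * (f (real k / real n) / sqrt (real n))" for n k :: nat
  have "(\<lambda>n. exp (- (t\<^sup>2 * (\<Sum>k=1..n. (f (real k / real n))\<^sup>2 / real n) / 2)))
      \<longlonglongrightarrow> exp (- (t\<^sup>2 * integral {0..1} (\<lambda>s. (f s)\<^sup>2) / 2))"
    by (intro tendsto_intros riemann_sum_tendsto continuous_intros cont) auto
  moreover have "exp (- (t\<^sup>2 * (\<Sum>k=1..n. (f (real k / real n))\<^sup>2 / real n) / 2))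
      = (\<Prod>k=1..n. exp (- ((x n k)\<^sup>2 / 2)))" for n
    by (simp add: exp_sum[symmetric] x_def sum_negf sum_distrib_left sum_divide_distrib
        power_mult_distrib power_divide)
  ultimately have lim: "(\<lambda>n. \<Prod>k=1..n. exp (- ((x n k)\<^sup>2 / 2)))
      \<longlonglongrightarrow> exp (- (t\<^sup>2 * integral {0..1} (\<lambda>s. (f s)\<^sup>2) / 2))"
    by simp
  have "bounded (f ` {0..1})"
    by (intro compact_imp_bounded compact_continuous_image cont) simp
  then obtain B where B: "\<And>s. s \<in> {0..1} \<Longrightarrow> \<bar>f s\<bar> \<le> B"
    unfolding bounded_real by blast
  \<comment> \<open>At n = 0 both products are empty and division by zero yields 0, so the bound
    holds for every n.\<close>
  have "\<bar>(\<Prod>k=1..n. cos (x n k)) - (\<Prod>k=1..n. exp (- ((x n k)\<^sup>2 / 2)))\<bar> \<le> (t * B) ^ 4 / real n"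
    for n
  proof -
    have "\<bar>(\<Prod>k=1..n. cos (x n k)) - (\<Prod>k=1..n. exp (- ((x n k)\<^sup>2 / 2)))\<bar>
        \<le> (\<Sum>k=1..n. \<bar>cos (x n k) - exp (- ((x n k)\<^sup>2 / 2))\<bar>)"
      using norm_prod_diff[of "{1..n}" "\<lambda>k. cos (x n k)" "\<lambda>k. exp (- ((x n k)\<^sup>2 / 2))"] by simp
    also have "\<dots> \<le> (\<Sum>k=1..n. (t * B) ^ 4 / (real n)\<^sup>2)"
    proof (rule sum_mono)
      fix k assume k: "k \<in> {1..n}"
      have "\<bar>cos (x n k) - exp (- ((x n k)\<^sup>2 / 2))\<bar> \<le> x n k ^ 4"
        by (rule cos_minus_exp_bound)
      \<comment> \<open>The even power allows \<open>\<bar>f\<bar>\<close> in place of f, so that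
        monotonicity of powers applies to the bound B.\<close>
      also have "\<dots> = t ^ 4 * \<bar>f (real k / real n)\<bar> ^ 4 / sqrt (real n) ^ 4"
        by (simp add: x_def power_mult_distrib power_divide)
      also have "sqrt (real n) ^ 4 = (sqrt (real n) ^ 2) ^ 2" by (simp only: power_mult[symmetric]) simp
      also have "\<dots> = (real n)\<^sup>2" by simp
      also have "t ^ 4 * \<bar>f (real k / real n)\<bar> ^ 4 / (real n)\<^sup>2 \<le> t ^ 4 * B ^ 4 / (real n)\<^sup>2"
        using k by (intro divide_right_mono mult_left_mono power_mono B) auto
      finally show "\<bar>cos (x n k) - exp (- ((x n k)\<^sup>2 / 2))\<bar> \<le> (t * B) ^ 4 / (real n)\<^sup>2"
        by (simp add: power_mult_distrib)
    qed
    also have "\<dots> = (t * B) ^ 4 / real n"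
      by (simp add: power2_eq_square)
    finally show ?thesis .
  qed
  then have "(\<lambda>n. (\<Prod>k=1..n. cos (x n k)) - (\<Prod>k=1..n. exp (- ((x n k)\<^sup>2 / 2)))) \<longlonglongrightarrow> 0"
    by (intro Lim_null_comparison[OF always_eventually lim_const_over_n]) auto
  then show ?thesis
    using lim unfolding x_def[symmetric] by (rule Lim_transform[rotated])
qed

theorem theorem2:
  fixes M :: "'a measure"
    and \<epsilon> :: "nat \<Rightarrow> 'a \<Rightarrow> real"
    and f :: "real \<Rightarrow> real"
  assumes "prob_space M"
    and "prob_space.indep_vars M (\<lambda>_. borel) \<epsilon> {1..}"
    and "\<And>k. k \<ge> 1 \<Longrightarrow> measure M {\<omega> \<in> space M. \<epsilon> k \<omega> = 1} = 1 / 2"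
    and "\<And>k. k \<ge> 1 \<Longrightarrow> measure M {\<omega> \<in> space M. \<epsilon> k \<omega> = -1} = 1 / 2"
    and "continuous_on {0..1} f"
  shows "weak_conv_m (\<lambda>n. distr M borel (phi \<epsilon> n f))
           (normal_dist 0 (integral {0..1} (\<lambda>s. (f s)\<^sup>2)))"
proof -
  interpret prob_space M by fact
  have meas: "random_variable borel (\<epsilon> k)" if "k \<ge> 1" for k
    using assms(2) that unfolding indep_vars_def2 by simp
  define c where "c n k = f (real k / real n) / sqrt (real n)" for n k :: nat
  have phi: "phi \<epsilon> n f = (\<lambda>\<omega>. \<Sum>k=1..n. c n k * \<epsilon> k \<omega>)" for n
    by (simp add: phi_def c_def fun_eq_iff)
  \<comment> \<open>Nonnegative variance is what makes the limit a probability law with the expected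
    characteristic function.\<close>
  have v: "integral {0..1} (\<lambda>s. (f s)\<^sup>2) \<ge> 0"
    by (intro integral_nonneg integrable_continuous_real continuous_intros assms(5)) simp
  have char_phi: "char (distr M borel (phi \<epsilon> n f)) t = (\<Prod>k=1..n. cos (t * c n k))" for n t
  proof -
    have "indep_vars (\<lambda>_. borel) \<epsilon> {1..n}"
      by (rule indep_vars_subset[OF assms(2)]) auto
    then have "indep_vars (\<lambda>_. borel) (\<lambda>k \<omega>. c n k * \<epsilon> k \<omega>) {1..n}"
      by (rule indep_vars_compose2) simp
    then have "char (distr M borel (phi \<epsilon> n f)) t
        = (\<Prod>k=1..n. char (distr M borel (\<lambda>\<omega>. c n k * \<epsilon> k \<omega>)) t)"
      unfolding phi by (rule char_distr_sum)
    also have "\<dots> = (\<Prod>k=1..n. complex_of_real (cos (t * c n k)))"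
      by (intro prod.cong refl char_distr_scaled_sign meas assms(3,4)) auto
    finally show ?thesis by simp
  qed
  show ?thesis
  proof (rule levy_continuity)
    fix n
    have "random_variable borel (phi \<epsilon> n f)"
      unfolding phi by (intro borel_measurable_sum borel_measurable_times meas) auto
    then show "real_distribution (distr M borel (phi \<epsilon> n f))"
      by (rule real_distribution_distr)
  next
    show "real_distribution (normal_dist 0 (integral {0..1} (\<lambda>s. (f s)\<^sup>2)))"
      by (rule real_distribution_normal_dist[OF v])
  next
    fix t
    show "(\<lambda>n. char (distr M borel (phi \<epsilon> n f)) t)
        \<longlonglongrightarrow> char (normal_dist 0 (integral {0..1} (\<lambda>s. (f s)\<^sup>2))) t"
      unfolding char_phi char_normal_dist[OF v] c_def
      by (intro tendsto_of_real prod_cos_tendsto assms(5))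
  qed
qed

end
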